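(* Let $\xi\in L^\infty(D)$ be a complex scalar field written as $\xi(\mathbf{x})=|\xi(\mathbf{x})|\,e^{i\varphi_\xi(\mathbf{x})}$ with $\varphi_\xi(\mathbf{x})\in\mathbb{R}$. The field $\xi$ is elliptic if and only if $\operatorname{ess\,inf}_{\mathbf{x}\in D}|\xi(\mathbf{x})|>0$ and there exist $\theta_\xi\in\mathbb{R}$ and $\eta_\xi\in\,]0,\pi/2]$ such that, for almost every $\mathbf{x}\in D$, $$\theta_\xi+\varphi_\xi(\mathbf{x})\in\bigcup_{n\in\mathbb{Z}}\big[2n\pi-(\pi/2-\eta_\xi),\ 2n\pi+(\pi/2-\eta_\xi)\big].$$ In addition, when $\xi$ is elliptic, $\eta_\xi$ can be chosen arbitrarily close to $0$.
   Context: $D\subset\mathbb{R}^3$ is a bounded measurable set of positive measure. $L^\infty(D)$ is the space of complex-valued essentially bounded measurable functions on $D$. A scalar field $\xi=|\xi|e^{i\varphi_\xi}\in L^\infty(D)$ is called elliptic if there exist $\theta_\xi\in\mathbb{R}$ and $\xi_->0$ such that $|\xi(\mathbf{x})|\cos(\theta_\xi+\varphi_\xi(\mathbf{x}))\ge\xi_-$ for almost every $\mathbf{x}\in D$ (equivalently $\mathrm{Re}\{e^{i\theta_\xi}\xi(\mathbf{x})\}\ge\xi_-$ a.e.). Half-open and open intervals are written $]a,b]$, $]a,b[$. *)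

theory Defs
  imports "HOL-Probability.Essential_Supremum"
begin

(* Elements are functions rather than classes modulo null sets. *)
definition Linfty :: "'a::euclidean_space set \<Rightarrow> ('a \<Rightarrow> complex) set" where
  "Linfty D = {f \<in> borel_measurable (lebesgue_on D).
     esssup (lebesgue_on D) (\<lambda>x. ereal (cmod (f x))) < \<infinity>}"

definition essinf :: "'a measure \<Rightarrow> ('a \<Rightarrow> ereal) \<Rightarrow> ereal" where
  "essinf M f = - esssup M (\<lambda>x. - f x)"

lemma essinf_eq_AE:
  assumes "f \<in> borel_measurable M"
  shows "essinf M f = Sup {z. AE x in M. z \<le> f x}"
proof -
  have "(\<lambda>x. - f x) \<in> borel_measurable M"
    using assms by measurable
  then have "essinf M f = - Inf {z. AE x in M. - f x \<le> z}"
    by (simp add: essinf_def esssup_eq_AE)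
  also have "{z. AE x in M. - f x \<le> z} = uminus ` {z. AE x in M. z \<le> f x}"
    by (auto simp: image_iff ereal_uminus_le_reorder intro!: exI[of _ "- _"])
  finally show ?thesis
    by (simp add: ereal_Inf_uminus_image_eq)
qed

(* \<phi> is the phase in the representation \<xi> = |\<xi>| exp (i \<phi>); by elliptic_iff_Re
   the notion does not depend on which phase is chosen. *)
definition elliptic ::
  "'a::euclidean_space set \<Rightarrow> ('a \<Rightarrow> complex) \<Rightarrow> ('a \<Rightarrow> real) \<Rightarrow> bool" where
  "elliptic D \<xi> \<phi> \<longleftrightarrow>
     (\<exists>\<theta>::real. \<exists>m>0. AE x in lebesgue_on D. cmod (\<xi> x) * cos (\<theta> + \<phi> x) \<ge> m)"

lemma elliptic_iff_Re:
  assumes "AE x in lebesgue_on D. \<xi> x = complex_of_real (cmod (\<xi> x)) * exp (\<i> * complex_of_real (\<phi> x))"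
  shows "elliptic D \<xi> \<phi> \<longleftrightarrow>
    (\<exists>\<theta>::real. \<exists>m>0. AE x in lebesgue_on D. Re (exp (\<i> * complex_of_real \<theta>) * \<xi> x) \<ge> m)"
proof -
  have polar: "Re (exp (\<i> * complex_of_real \<theta>) * z) = cmod z * cos (\<theta> + p)"
    if "z = complex_of_real (cmod z) * exp (\<i> * complex_of_real p)" for \<theta> p z
  proof -
    have "exp (\<i> * complex_of_real \<theta>) * z = complex_of_real (cmod z) * cis (\<theta> + p)"
      by (subst that) (simp add: cis_conv_exp[symmetric] cis_mult[symmetric] mult_ac)
    then show ?thesis by simp
  qed
  have "(AE x in lebesgue_on D. cmod (\<xi> x) * cos (\<theta> + \<phi> x) \<ge> m) \<longleftrightarrow>
        (AE x in lebesgue_on D. Re (exp (\<i> * complex_of_real \<theta>) * \<xi> x) \<ge> m)" for \<theta> m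
    by (rule eventually_cong[OF assms]) (simp only: polar)
  then show ?thesis
    by (simp add: elliptic_def)
qed

end

theory Submission
  imports Defs
begin

text \<open>
  A real t lies in the union of the closed arcs of half-width pi/2 - \<eta> around the multiples
  of 2 pi exactly when sin \<eta> \<le> cos t, so the cone condition bounds the cosine away from 0.
  Together with the bounds on \<open>cmod \<xi>\<close> this controls \<open>cmod \<xi> * cos\<close> from below; conversely,
  if m \<le> \<open>cmod \<xi> * cos\<close> and \<open>cmod \<xi>\<close> \<le> M, then cos \<ge> m/M, and since sin \<eta> \<le> \<eta>
  every \<eta> \<le> m/M is admissible.
\<close>

lemma mem_arcs_iff_sin_le_cos:
  fixes t \<eta> :: real
  assumes "0 \<le> \<eta>" "\<eta> \<le> pi/2"
  shows "t \<in> (\<Union>n::int. {2 * of_int n * pi - (pi/2 - \<eta>) .. 2 * of_int n * pi + (pi/2 - \<eta>)})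
    \<longleftrightarrow> sin \<eta> \<le> cos t"
proof -
  \<comment> \<open>Cosine is even and strictly decreasing on [0, pi], so once t is reduced to
    within pi of \<open>2 * of_int n * pi\<close>, comparing \<open>cos t\<close> with
    \<open>sin \<eta> = cos (pi/2 - \<eta>)\<close> amounts to comparing arguments.\<close>
  have shift: "t \<in> {2 * of_int n * pi - (pi/2 - \<eta>) .. 2 * of_int n * pi + (pi/2 - \<eta>)}
      \<longleftrightarrow> sin \<eta> \<le> cos t" if "\<bar>t - 2 * of_int n * pi\<bar> \<le> pi" for n :: int
  proof -
    have "cos t = cos \<bar>t - 2 * of_int n * pi\<bar>"
      using cos_int_2pin[of n] sin_int_2pin[of n] by (simp add: cos_diff mult_ac)
    moreover have "sin \<eta> = cos (pi/2 - \<eta>)"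
      by (simp add: cos_diff)
    ultimately have "sin \<eta> \<le> cos t \<longleftrightarrow> \<bar>t - 2 * of_int n * pi\<bar> \<le> pi/2 - \<eta>"
      using that assms cos_mono_le_eq[of "pi/2 - \<eta>" "\<bar>t - 2 * of_int n * pi\<bar>"] by simp
    then show ?thesis
      by auto
  qed
  \<comment> \<open>The multiple of 2 pi nearest to t lies within pi of it; this gives an index for
    \<open>shift\<close> when only the cosine bound is known.\<close>
  define k where "k = round (t / (2 * pi))"
  have "\<bar>t - 2 * of_int k * pi\<bar> = 2 * pi * \<bar>of_int k - t / (2 * pi)\<bar>"
    by (simp add: abs_mult_pos' right_diff_distrib abs_minus_commute mult_ac)
  also have "\<dots> \<le> 2 * pi * (1/2)"
    unfolding k_def by (intro mult_left_mono of_int_round_abs_le) simp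
  finally have "\<bar>t - 2 * of_int k * pi\<bar> \<le> pi"
    by simp
  \<comment> \<open>Conversely, an arc has half-width at most pi/2, so \<open>shift\<close> applies
    to the index of any arc containing t.\<close>
  moreover have "\<bar>t - 2 * of_int n * pi\<bar> \<le> pi"
    if "t \<in> {2 * of_int n * pi - (pi/2 - \<eta>) .. 2 * of_int n * pi + (pi/2 - \<eta>)}" for n :: int
    using that assms pi_gt_zero by (auto simp: abs_le_iff)
  ultimately show ?thesis
    using shift by blast
qed

lemma Linfty_AE_bounded:
  assumes "\<xi> \<in> Linfty D"
  obtains M where "0 < M" "AE x in lebesgue_on D. cmod (\<xi> x) \<le> M"
proof -
  have "esssup (lebesgue_on D) (\<lambda>x. ereal (cmod (\<xi> x))) < \<infinity>"
    using assms by (simp add: Linfty_def)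
  then obtain M where M: "esssup (lebesgue_on D) (\<lambda>x. ereal (cmod (\<xi> x))) < ereal M"
    using ereal_dense2 by blast
  have "AE x in lebesgue_on D. ereal (cmod (\<xi> x)) \<le> esssup (lebesgue_on D) (\<lambda>x. ereal (cmod (\<xi> x)))"
    by (rule esssup_AE)
  \<comment> \<open>The maximum with 1 makes the bound positive, so that one may divide by
    it.\<close>
  then have "AE x in lebesgue_on D. cmod (\<xi> x) \<le> max M 1"
  proof (rule eventually_mono)
    fix x assume "ereal (cmod (\<xi> x)) \<le> esssup (lebesgue_on D) (\<lambda>x. ereal (cmod (\<xi> x)))"
    with M have "ereal (cmod (\<xi> x)) < ereal M"
      by (rule le_less_trans[rotated])
    then show "cmod (\<xi> x) \<le> max M 1"
      by simp
  qed
  then show ?thesis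
    by (rule that[rotated]) simp
qed

lemma essinf_pos_iff:
  fixes f :: "'a \<Rightarrow> real"
  assumes "f \<in> borel_measurable M"
  shows "0 < essinf M (\<lambda>x. ereal (f x)) \<longleftrightarrow> (\<exists>m>0. AE x in M. m \<le> f x)"
proof -
  have "(\<lambda>x. ereal (f x)) \<in> borel_measurable M"
    using assms by measurable
  then have *: "0 < essinf M (\<lambda>x. ereal (f x)) \<longleftrightarrow> (\<exists>z>0. AE x in M. z \<le> ereal (f x))"
    by (auto simp: essinf_eq_AE less_Sup_iff)
  show ?thesis
  proof
    assume "0 < essinf M (\<lambda>x. ereal (f x))"
    then obtain z where "0 < z" and z: "AE x in M. z \<le> ereal (f x)"
      using * by blast
    \<comment> \<open>The bound z may be infinite (on a null measure), so a real number is chosen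
      strictly between 0 and z.\<close>
    then obtain m where m: "0 < ereal m" "ereal m < z"
      using ereal_dense2 by blast
    from z have "AE x in M. m \<le> f x"
      by (rule eventually_mono) (use m(2) in \<open>metis ereal_less_eq(3) less_imp_le order_trans\<close>)
    with m(1) show "\<exists>m>0. AE x in M. m \<le> f x"
      by auto
  next
    assume "\<exists>m>0. AE x in M. m \<le> f x"
    then obtain m where "0 < m" "AE x in M. m \<le> f x"
      by blast
    then show "0 < essinf M (\<lambda>x. ereal (f x))"
      unfolding * by (intro exI[of _ "ereal m"]) simp
  qed
qed

text \<open>The angle of ellipticity itself serves as \<theta>, so one \<theta> works for all
  \<epsilon>: shrinking \<eta> only widens the arcs.\<close>

lemma elliptic_imp_AE_arcs:
  assumes "elliptic D \<xi> \<phi>" "\<xi> \<in> Linfty D"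
  shows "\<exists>\<theta>::real. \<forall>\<epsilon>>0. \<exists>\<eta>\<in>{0<..pi/2}. \<eta> < \<epsilon> \<and> (AE x in lebesgue_on D.
    \<theta> + \<phi> x \<in> (\<Union>n::int. {2 * of_int n * pi - (pi/2 - \<eta>) .. 2 * of_int n * pi + (pi/2 - \<eta>)}))"
proof -
  obtain \<theta> m where m: "0 < m" "AE x in lebesgue_on D. m \<le> cmod (\<xi> x) * cos (\<theta> + \<phi> x)"
    using assms(1) unfolding elliptic_def by blast
  obtain M where M: "0 < M" "AE x in lebesgue_on D. cmod (\<xi> x) \<le> M"
    using Linfty_AE_bounded[OF assms(2)] .
  have cos: "AE x in lebesgue_on D. m / M \<le> cos (\<theta> + \<phi> x)"
    using m(2) M(2)
  proof eventually_elim
    case (elim x)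
    \<comment> \<open>The sign of the cosine is settled first: only a nonnegative factor allows
      \<open>cmod (\<xi> x)\<close> to be replaced by its upper bound M.\<close>
    then have "0 < cmod (\<xi> x) * cos (\<theta> + \<phi> x)"
      using m(1) by simp
    then have "0 \<le> cos (\<theta> + \<phi> x)"
      by (simp add: zero_less_mult_iff)
    then have "m \<le> M * cos (\<theta> + \<phi> x)"
      using elim by (meson mult_right_mono order_trans)
    then show ?case
      using M(1) by (simp add: pos_divide_le_eq mult.commute)
  qed
  show ?thesis
  proof (intro exI allI impI)
    fix \<epsilon> :: real assume "0 < \<epsilon>"
    \<comment> \<open>The three terms give, in turn, \<open>sin \<eta> \<le> m / M\<close>, the
      strict bound by \<epsilon>, and the admissible range.\<close>
    define \<eta> where "\<eta> = min (m / M) (min (\<epsilon> / 2) (pi / 2))"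
    have \<eta>: "0 < \<eta>" "\<eta> \<le> pi/2" "\<eta> < \<epsilon>" "\<eta> \<le> m / M"
      using m(1) M(1) \<open>0 < \<epsilon>\<close> unfolding \<eta>_def by (simp, linarith+)
    then have "sin \<eta> \<le> m / M"
      using sin_x_le_x[of \<eta>] by simp
    then have "AE x in lebesgue_on D. sin \<eta> \<le> cos (\<theta> + \<phi> x)"
      using cos by (auto elim: eventually_mono)
    then show "\<exists>\<eta>\<in>{0<..pi/2}. \<eta> < \<epsilon> \<and> (AE x in lebesgue_on D.
        \<theta> + \<phi> x \<in> (\<Union>n::int. {2 * of_int n * pi - (pi/2 - \<eta>) .. 2 * of_int n * pi + (pi/2 - \<eta>)}))"
      using \<eta> by (intro bexI[of _ \<eta>] conjI) (simp_all only: mem_arcs_iff_sin_le_cos less_imp_le greaterThanAtMost_iff)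
  qed
qed

text \<open>As the cosine is at most 1, the ellipticity constant also bounds the modulus from
  below.\<close>

lemma elliptic_imp_essinf_pos:
  assumes "elliptic D \<xi> \<phi>" "\<xi> \<in> borel_measurable (lebesgue_on D)"
  shows "0 < essinf (lebesgue_on D) (\<lambda>x. ereal (cmod (\<xi> x)))"
proof -
  obtain \<theta> m where m: "0 < m" "AE x in lebesgue_on D. m \<le> cmod (\<xi> x) * cos (\<theta> + \<phi> x)"
    using assms(1) unfolding elliptic_def by blast
  from m(2) have "AE x in lebesgue_on D. m \<le> cmod (\<xi> x)"
    by (rule eventually_mono) (metis cos_le_one mult_left_le norm_ge_zero order_trans)
  moreover have "(\<lambda>x. cmod (\<xi> x)) \<in> borel_measurable (lebesgue_on D)"
    using assms(2) by measurable
  ultimately show ?thesis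
    using m(1) essinf_pos_iff by blast
qed

text \<open>With the same \<theta>, the product of the lower bounds for modulus and cosine is an
  ellipticity constant; it is positive because \<eta> > 0 keeps the closed arcs away from the zeros
  of the cosine.\<close>

lemma elliptic_if_AE_arcs:
  assumes "\<xi> \<in> borel_measurable (lebesgue_on D)"
    and "0 < essinf (lebesgue_on D) (\<lambda>x. ereal (cmod (\<xi> x)))"
    and "0 < \<eta>" "\<eta> \<le> pi/2"
    and "AE x in lebesgue_on D.
      \<theta> + \<phi> x \<in> (\<Union>n::int. {2 * of_int n * pi - (pi/2 - \<eta>) .. 2 * of_int n * pi + (pi/2 - \<eta>)})"
  shows "elliptic D \<xi> \<phi>"
proof -
  have "(\<lambda>x. cmod (\<xi> x)) \<in> borel_measurable (lebesgue_on D)"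
    using assms(1) by measurable
  then obtain m where m: "0 < m" "AE x in lebesgue_on D. m \<le> cmod (\<xi> x)"
    using assms(2) essinf_pos_iff by blast
  have sin: "0 < sin \<eta>"
    using assms(3,4) by (intro sin_gt_zero) auto
  from assms(3-5) have "AE x in lebesgue_on D. sin \<eta> \<le> cos (\<theta> + \<phi> x)"
    by (simp only: mem_arcs_iff_sin_le_cos less_imp_le)
  with m(2) have "AE x in lebesgue_on D. m * sin \<eta> \<le> cmod (\<xi> x) * cos (\<theta> + \<phi> x)"
    by eventually_elim (use m(1) sin in \<open>auto intro: mult_mono\<close>)
  moreover have "0 < m * sin \<eta>"
    using m(1) sin by simp
  ultimately show ?thesis
    unfolding elliptic_def by blast
qed

theorem proposition3p6:
  fixes D :: "(real ^ 3) set" and \<xi> :: "real ^ 3 \<Rightarrow> complex" and \<phi> :: "real ^ 3 \<Rightarrow> real"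
  assumes "bounded D" and "D \<in> sets lebesgue" and "0 < measure lebesgue D"
    and "\<xi> \<in> Linfty D"
    and "AE x in lebesgue_on D. \<xi> x = complex_of_real (cmod (\<xi> x)) * exp (\<i> * complex_of_real (\<phi> x))"
  shows "(elliptic D \<xi> \<phi> \<longleftrightarrow>
            0 < essinf (lebesgue_on D) (\<lambda>x. ereal (cmod (\<xi> x))) \<and>
            (\<exists>\<theta>::real. \<exists>\<eta>\<in>{0<..pi/2}. AE x in lebesgue_on D.
               \<theta> + \<phi> x \<in> (\<Union>n::int. {2 * of_int n * pi - (pi/2 - \<eta>) .. 2 * of_int n * pi + (pi/2 - \<eta>)})))
       \<and> (elliptic D \<xi> \<phi> \<longrightarrow>
            (\<exists>\<theta>::real. \<forall>\<epsilon>>0. \<exists>\<eta>\<in>{0<..pi/2}. \<eta> < \<epsilon> \<and> (AE x in lebesgue_on D.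
               \<theta> + \<phi> x \<in> (\<Union>n::int. {2 * of_int n * pi - (pi/2 - \<eta>) .. 2 * of_int n * pi + (pi/2 - \<eta>)}))))"
proof -
  have meas: "\<xi> \<in> borel_measurable (lebesgue_on D)"
    using assms(4) by (simp add: Linfty_def)
  note arcs = elliptic_imp_AE_arcs[OF _ assms(4)]
  show ?thesis
  proof (intro conjI iffI impI)
    assume ell: "elliptic D \<xi> \<phi>"
    show "0 < essinf (lebesgue_on D) (\<lambda>x. ereal (cmod (\<xi> x)))"
      using elliptic_imp_essinf_pos[OF ell meas] .
    show "\<exists>\<theta>::real. \<exists>\<eta>\<in>{0<..pi/2}. AE x in lebesgue_on D.
        \<theta> + \<phi> x \<in> (\<Union>n::int. {2 * of_int n * pi - (pi/2 - \<eta>) .. 2 * of_int n * pi + (pi/2 - \<eta>)})"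
      \<comment> \<open>Any positive \<epsilon> would do here; \<epsilon> = 1 is taken.\<close>
      using arcs[OF ell] zero_less_one by blast
  qed (use arcs elliptic_if_AE_arcs[OF meas] in \<open>fastforce+\<close>)
qed

end
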